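(* Consider an instance of the problem $1|pmtn; r_j, p_j|F(C_j)$ with integer release times $r_j$, integer processing times $p_j$, and an objective function $F$ that is an increasing function of the completion times. Then in an optimal schedule there are no intersecting jobs; that is, there are no two distinct jobs $i$ and $j$ such that $i$ intersects $j$ and $j$ intersects $i$.
   Context: The problem $1|pmtn; r_j, p_j|F(C_j)$: there are $n$ jobs $1,\dots,n$ to be processed on a single machine, which can process at most one job at each point in time. Job $j$ has an integer release time $r_j\ge 0$ and a positive integer processing time $p_j$. Job $j$ becomes available for processing at the moment $r_j$ (it cannot be processed before time $r_j$) and must be processed for a total time of $p_j$. Preemptions of one job in favor of another are allowed at any (real) time and any (finite) number of times. A schedule specifies which job is processed when: job $j$ is processed on a finite union of intervals of the form $(a,b]$ of real time, and the sets for different jobs are disjoint. It is feasible if no job is processed before its release time and each job $j$ is processed for exactly $p_j$ time. The completion time $C_j$ of job $j$ is the earliest point in time at which it has been processed for $p_j$ time. The objective $F=F(C_1,\dots,C_n)$ is increasing in the completion times: if $C_j\le C_j'$ for all $j$ with strict inequality for at least one $j$, then $F(C_1,\dots,C_n)<F(C_1',\dots,C_n')$. A schedule is optimal if it is feasible and minimizes $F$ among all feasible schedules. Standing assumption: optimal schedules contain no idle time, i.e. with $T=\sum_{j=1}^n p_j$ and time measured from the start of processing, the machine is busy throughout $(0,T]$. In a given schedule, job $i$ intersects job $j$ ($i\neq j$) if some of job $i$'s processing takes place in between some of job $j$'s processing, i.e. after some processing of $j$ and before some other processing of $j$. Jobs $i$ and $j$ are intersecting if $i$ intersects $j$ and $j$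 intersects $i$. *)

theory Defs
  imports "HOL-Analysis.Analysis"
begin

text \<open>
  Jobs are the elements of a finite type \<open>'j\<close>, so the number of jobs is \<open>CARD('j)\<close>.
  Release and processing times are \<open>r, p :: 'j \<Rightarrow> nat\<close>. A schedule maps every job to the set
  of times at which it is processed.
\<close>

definition is_schedule :: "('j \<Rightarrow> real set) \<Rightarrow> bool" where
  "is_schedule S \<longleftrightarrow>
     (\<forall>j. \<exists>I :: (real \<times> real) set. finite I \<and> S j = (\<Union>(a, b)\<in>I. {a<..b})) \<and>
     disjoint_family S"

text \<open>
  As intervals are open on the left, a job that starts exactly at its release time occupies an
  interval \<open>{r<..b}\<close>; hence the strict lower bound.
\<close>

definition feasible :: "('j \<Rightarrow> nat) \<Rightarrow> ('j \<Rightarrow> nat) \<Rightarrow> ('j \<Rightarrow> real set) \<Rightarrow> bool" where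
  "feasible r p S \<longleftrightarrow>
     is_schedule S \<and>
     (\<forall>j. S j \<subseteq> {real (r j)<..}) \<and>
     (\<forall>j. measure lborel (S j) = real (p j))"

text \<open>For feasible schedules the least such time exists.\<close>

definition completion_time :: "('j \<Rightarrow> nat) \<Rightarrow> ('j \<Rightarrow> real set) \<Rightarrow> 'j \<Rightarrow> real" where
  "completion_time p S j = (LEAST t. measure lborel (S j \<inter> {..t}) = real (p j))"

text \<open>
  Monotonicity is required only for positive vectors: all processing times are positive, so
  completion times are positive, and objectives such as the sum of the squared completion times
  are increasing there but not on all real vectors.
\<close>

definition increasing_objective :: "(('j \<Rightarrow> real) \<Rightarrow> real) \<Rightarrow> bool" where
  "increasing_objective F \<longleftrightarrow>
     (\<forall>C C'. (\<forall>j. 0 < C j) \<and> (\<forall>j. C j \<le> C' j) \<and> (\<exists>j. C j < C' j) \<longrightarrow> F C < F C')"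

definition optimal ::
  "('j \<Rightarrow> nat) \<Rightarrow> ('j \<Rightarrow> nat) \<Rightarrow> (('j \<Rightarrow> real) \<Rightarrow> real) \<Rightarrow> ('j \<Rightarrow> real set) \<Rightarrow> bool" where
  "optimal r p F S \<longleftrightarrow>
     feasible r p S \<and>
     (\<forall>S'. feasible r p S' \<longrightarrow> F (completion_time p S) \<le> F (completion_time p S'))"

text \<open>Time is measured from the start of processing, so the busy period begins at 0.\<close>

definition no_idle_time :: "('j::finite \<Rightarrow> nat) \<Rightarrow> ('j \<Rightarrow> real set) \<Rightarrow> bool" where
  "no_idle_time p S \<longleftrightarrow> {0<..real (\<Sum>j\<in>UNIV. p j)} \<subseteq> (\<Union>j. S j)"

definition intersects :: "('j \<Rightarrow> real set) \<Rightarrow> 'j \<Rightarrow> 'j \<Rightarrow> bool" where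
  "intersects S i j \<longleftrightarrow>
     i \<noteq> j \<and> (\<exists>s\<in>S j. \<exists>t\<in>S i. \<exists>u\<in>S j. s < t \<and> t < u)"

definition intersecting :: "('j \<Rightarrow> real set) \<Rightarrow> 'j \<Rightarrow> 'j \<Rightarrow> bool" where
  "intersecting S i j \<longleftrightarrow> intersects S i j \<and> intersects S j i"

end

theory Submission
  imports Defs
begin

text \<open>
  Suppose that in an optimal schedule job \<open>j\<close> is processed at a time \<open>t\<close> which lies after some
  processing of \<open>i\<close> and before the completion \<open>C\<^sub>i\<close>. Then \<open>i\<close> is already released at \<open>t\<close>, so a short
  piece of \<open>j\<close> that ends at \<open>t\<close> can change places with the equally long final piece of \<open>i\<close>. This
  strictly decreases \<open>C\<^sub>i\<close>, because what is left of \<open>i\<close> is done before its old final piece, and the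
  latest point at which \<open>j\<close> can now be completed is the larger of \<open>C\<^sub>i\<close> and \<open>C\<^sub>j\<close>. If \<open>C\<^sub>i \<le> C\<^sub>j\<close>, no
  completion time increases, and the exchange contradicts optimality. Hence, in an optimal schedule,
  a job that intersects another one is completed strictly before it
  (\<open>optimal_intersects_imp_completes_earlier\<close>). Two intersecting jobs would then each have to be
  completed before the other.
\<close>

section \<open>Finite unions of half-open intervals\<close>

definition interval_union :: "real set \<Rightarrow> bool" where
  "interval_union X \<longleftrightarrow> (\<exists>I. finite I \<and> X = (\<Union>(a, b)\<in>I. {a<..b}))"

lemma interval_union_empty: "interval_union {}"
  unfolding interval_union_def by (rule exI[of _ "{}"]) auto

lemma interval_union_Ioc: "interval_union {a<..b}"
  unfolding interval_union_def by (rule exI[of _ "{(a, b)}"]) auto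

lemma interval_union_Un:
  assumes "interval_union X" "interval_union Y"
  shows "interval_union (X \<union> Y)"
proof -
  obtain I where I: "finite I" "X = (\<Union>(a, b)\<in>I. {a<..b})"
    using assms(1) unfolding interval_union_def by blast
  obtain J where J: "finite J" "Y = (\<Union>(a, b)\<in>J. {a<..b})"
    using assms(2) unfolding interval_union_def by blast
  have "X \<union> Y = (\<Union>(a, b)\<in>I \<union> J. {a<..b})" using I J by auto
  then show ?thesis using I J unfolding interval_union_def by blast
qed

lemma interval_union_UN:
  assumes "finite I" "\<And>i. i \<in> I \<Longrightarrow> interval_union (X i)"
  shows "interval_union (\<Union>i\<in>I. X i)"
  using assms by (induction I) (auto intro: interval_union_empty interval_union_Un)

lemma interval_union_Diff_Ioc:
  assumes "interval_union X"
  shows "interval_union (X - {c<..d})"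
proof -
  obtain I where I: "finite I" "X = (\<Union>(a, b)\<in>I. {a<..b})"
    using assms unfolding interval_union_def by blast
  have "X - {c<..d} = (\<Union>q\<in>I. {fst q<..min (snd q) c} \<union> {max (fst q) d<..snd q})"
    unfolding I by (auto simp: not_le)
  then show ?thesis
    using I by (auto intro!: interval_union_UN interval_union_Un interval_union_Ioc)
qed

lemma interval_union_fmeasurable:
  assumes "interval_union X"
  shows "X \<in> fmeasurable lborel"
proof -
  obtain I where I: "finite I" "X = (\<Union>(a, b)\<in>I. {a<..b})"
    using assms unfolding interval_union_def by blast
  have "{a<..b} \<in> fmeasurable lborel" for a b :: real
    by (cases "a \<le> b") (auto simp: fmeasurable_def)
  then show ?thesis unfolding I using I(1) by (auto intro!: fmeasurable.finite_UN)
qed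

text \<open>
  This provides the pieces to be exchanged. It relies on the intervals being open on the left, so
  that none of their points lacks room before it.
\<close>

lemma interval_union_left_neighbourhood:
  assumes "interval_union X" "x \<in> X"
  obtains a where "a < x" "{a<..x} \<subseteq> X"
proof -
  obtain I where I: "finite I" "X = (\<Union>(a, b)\<in>I. {a<..b})"
    using assms(1) unfolding interval_union_def by blast
  then obtain a b where "(a, b) \<in> I" "a < x" "x \<le> b" using assms(2) by auto
  then have "{a<..x} \<subseteq> X" unfolding I by (intro subsetI UN_I[of "(a, b)"]) auto
  with \<open>a < x\<close> show ?thesis using that by blast
qed

lemma interval_union_has_greatest:
  assumes "interval_union X" "X \<noteq> {}"
  obtains m where "m \<in> X" "X \<subseteq> {..m}"
proof -
  obtain I where I: "finite I" "X = (\<Union>(a, b)\<in>I. {a<..b})"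
    using assms(1) unfolding interval_union_def by blast
  \<comment> \<open>Pairs with \<open>b \<le> a\<close> stand for the empty interval; their right ends must not count.\<close>
  define B where "B = snd ` {q\<in>I. fst q < snd q}"
  have fin: "finite B" unfolding B_def using I by auto
  have B: "\<exists>b\<in>B. x \<le> b" if "x \<in> X" for x using that unfolding I B_def by force
  with assms(2) have "B \<noteq> {}" by blast
  then have "Max B \<in> B" using fin by simp
  then have "Max B \<in> X" unfolding I B_def by force
  moreover have "X \<subseteq> {..Max B}" using B Max_ge[OF fin] by force
  ultimately show ?thesis using that by blast
qed

lemma measure_Int_atMost_less:
  assumes "interval_union X" "m \<in> X" "t < m"
  shows "measure lborel (X \<inter> {..t}) < measure lborel X"
proof -
  obtain a where a: "a < m" "{a<..m} \<subseteq> X"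
    using interval_union_left_neighbourhood assms by blast
  let ?J = "{max a t<..m}"
  have X: "X \<in> fmeasurable lborel" using assms by (intro interval_union_fmeasurable)
  have XJ: "X - ?J \<in> fmeasurable lborel"
    using assms by (intro interval_union_fmeasurable interval_union_Diff_Ioc)
  have "measure lborel (X \<inter> {..t}) \<le> measure lborel (X - ?J)"
    using X XJ by (intro measure_mono_fmeasurable) (auto simp: fmeasurable_def)
  also have "\<dots> = measure lborel X - measure lborel ?J"
    using a X by (intro measurable_measure_Diff) auto
  also have "\<dots> < measure lborel X" using a assms by simp
  finally show ?thesis .
qed

section \<open>Completion times of feasible schedules\<close>

lemma feasible_interval_union: "feasible r p S \<Longrightarrow> interval_union (S j)"
  unfolding feasible_def is_schedule_def interval_union_def by blast

text \<open>
  Before the greatest point of \<open>S j\<close> a nontrivial interval of processing is still missing, so the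
  infimum in the definition of the completion time is attained exactly there.
\<close>

lemma completion_time_is_greatest:
  assumes "feasible r p S" "0 < p j"
  shows "completion_time p S j \<in> S j \<and> S j \<subseteq> {..completion_time p S j}"
proof -
  have iu: "interval_union (S j)" using assms(1) by (rule feasible_interval_union)
  have meas: "measure lborel (S j) = real (p j)" using assms(1) unfolding feasible_def by blast
  then have "S j \<noteq> {}" using assms(2) by auto
  then obtain m where m: "m \<in> S j" "S j \<subseteq> {..m}" using interval_union_has_greatest iu by blast
  have "completion_time p S j = m"
    unfolding completion_time_def
  proof (rule Least_equality)
    show "measure lborel (S j \<inter> {..m}) = real (p j)" using m meas by (simp add: Int_absorb2)
    show "m \<le> t" if "measure lborel (S j \<inter> {..t}) = real (p j)" for t
      using that measure_Int_atMost_less[OF iu m(1), of t] meas by force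
  qed
  with m show ?thesis by simp
qed

lemma completion_time_pos:
  assumes "feasible r p S" "0 < p j"
  shows "0 < completion_time p S j"
proof -
  have "real (r j) < completion_time p S j"
    using completion_time_is_greatest[OF assms] assms(1) unfolding feasible_def by auto
  then show ?thesis by (rule le_less_trans[OF of_nat_0_le_iff])
qed

section \<open>Exchanging pieces of two jobs\<close>

definition exchange ::
  "'j \<Rightarrow> real set \<Rightarrow> 'j \<Rightarrow> real set \<Rightarrow> ('j \<Rightarrow> real set) \<Rightarrow> 'j \<Rightarrow> real set" where
  "exchange i P j Q S = S(i := (S i - P) \<union> Q, j := (S j - Q) \<union> P)"

lemma measure_replace:
  assumes "A \<in> fmeasurable M" "P \<in> fmeasurable M" "Q \<in> fmeasurable M"
    and "P \<subseteq> A" "A \<inter> Q = {}" "measure M P = measure M Q"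
  shows "measure M ((A - P) \<union> Q) = measure M A"
proof -
  have "A - P \<in> fmeasurable M" using assms by (intro fmeasurable.Diff)
  then have "measure M ((A - P) \<union> Q) = measure M (A - P) + measure M Q"
    using assms by (intro measure_Union) (auto simp: fmeasurable_def)
  also have "measure M (A - P) = measure M A - measure M P"
    using assms by (intro measurable_measure_Diff) auto
  finally show ?thesis using assms by simp
qed

lemma feasible_exchange:
  assumes feas: "feasible r p S" and "i \<noteq> j"
    and P: "{a<..b} \<subseteq> S i" "{a<..b} \<subseteq> {real (r j)<..}"
    and Q: "{c<..d} \<subseteq> S j" "{c<..d} \<subseteq> {real (r i)<..}"
    and len: "measure lborel {a<..b} = measure lborel {c<..d}"
  shows "feasible r p (exchange i {a<..b} j {c<..d} S)" (is "feasible r p ?S'")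
proof -
  have disj: "S k \<inter> S l = {}" if "k \<noteq> l" for k l
    using feas that unfolding feasible_def is_schedule_def disjoint_family_on_def by blast
  have rel: "S k \<subseteq> {real (r k)<..}" and meas: "measure lborel (S k) = real (p k)" for k
    using feas unfolding feasible_def by blast+
  have iu: "interval_union (S k)" for k using feas by (rule feasible_interval_union)
  note fm = interval_union_fmeasurable
  have ius: "interval_union (?S' k)" for k
    unfolding exchange_def using iu
    by (auto intro!: interval_union_Un interval_union_Diff_Ioc interval_union_Ioc)
  \<comment> \<open>At the points of the two pieces the jobs \<open>i\<close> and \<open>j\<close> change roles; elsewhere nothing changes.\<close>
  define \<sigma> where "\<sigma> k = (if k = i then j else if k = j then i else k)" for k
  have owner: "x \<in> ?S' k \<longleftrightarrow> x \<in> S (if x \<in> {a<..b} \<union> {c<..d} then \<sigma> k else k)" for x k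
  proof -
    have "x \<in> {a<..b} \<Longrightarrow> x \<in> S l \<longleftrightarrow> l = i" "x \<in> {c<..d} \<Longrightarrow> x \<in> S l \<longleftrightarrow> l = j" for l
      using P(1) Q(1) disj by blast+
    then show ?thesis
      using \<open>i \<noteq> j\<close> unfolding exchange_def \<sigma>_def
      by (cases "x \<in> {a<..b}"; cases "x \<in> {c<..d}") (auto simp del: greaterThanAtMost_iff)
  qed
  have inj: "\<sigma> k \<noteq> \<sigma> l" if "k \<noteq> l" for k l using that \<open>i \<noteq> j\<close> unfolding \<sigma>_def by auto
  have disj': "?S' k \<inter> ?S' l = {}" if "k \<noteq> l" for k l
    using disj[OF that] disj[OF inj[OF that]] by (auto simp: owner split: if_splits)
  have rel': "?S' k \<subseteq> {real (r k)<..}" for k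
    using rel[of k] P(2) Q(2) unfolding exchange_def by auto
  have meas': "measure lborel (?S' k) = real (p k)" for k
  proof -
    have "measure lborel ((S i - {a<..b}) \<union> {c<..d}) = measure lborel (S i)"
      using P Q disj[OF \<open>i \<noteq> j\<close>] len
      by (intro measure_replace fm iu interval_union_Ioc) auto
    moreover have "measure lborel ((S j - {c<..d}) \<union> {a<..b}) = measure lborel (S j)"
      using P Q disj[OF \<open>i \<noteq> j\<close>] len
      by (intro measure_replace fm iu interval_union_Ioc) auto
    ultimately show ?thesis unfolding exchange_def using meas by simp
  qed
  have "is_schedule ?S'"
    using ius disj' unfolding is_schedule_def disjoint_family_on_def interval_union_def by auto
  then show ?thesis unfolding feasible_def using rel' meas' by simp
qed

section \<open>Intersecting jobs in optimal schedules\<close>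

lemma optimal_no_smaller_completion_times:
  assumes "\<And>k. 0 < p k" "increasing_objective F" "optimal r p F S" "feasible r p S'"
    and "\<And>k. completion_time p S' k \<le> completion_time p S k"
  shows "completion_time p S' k = completion_time p S k"
proof (rule ccontr)
  assume "completion_time p S' k \<noteq> completion_time p S k"
  then have "completion_time p S' k < completion_time p S k"
    using assms(5)[of k] by simp
  moreover have "0 < completion_time p S' k" for k
    using completion_time_pos[of r p S' k] assms(1,4) by simp
  ultimately have "F (completion_time p S') < F (completion_time p S)"
    using assms(2)[unfolded increasing_objective_def, rule_format,
        of "completion_time p S'" "completion_time p S"] assms(5) by auto
  moreover have "F (completion_time p S) \<le> F (completion_time p S')"
    using assms(3,4) unfolding optimal_def by simp
  ultimately show False by simp
qed

text \<open>
  If \<open>C\<^sub>i \<le> C\<^sub>j\<close>, exchanging the final piece of \<open>i\<close> with a piece of \<open>j\<close> that lies between two times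
  at which \<open>i\<close> is processed gives a better schedule.
\<close>

lemma optimal_intersects_imp_completes_earlier:
  assumes pos: "\<And>k. 0 < p k" and F: "increasing_objective F" and opt: "optimal r p F S"
    and ints: "intersects S j i"
  shows "completion_time p S j < completion_time p S i"
proof (rule ccontr)
  let ?C = "completion_time p S"
  assume "\<not> ?C j < ?C i"
  then have le: "?C i \<le> ?C j" by simp
  have feas: "feasible r p S" using opt unfolding optimal_def by blast
  have rel: "S k \<subseteq> {real (r k)<..}" for k using feas unfolding feasible_def by blast
  have C: "?C k \<in> S k" "S k \<subseteq> {..?C k}" for k
    using completion_time_is_greatest[OF feas pos] by blast+
  obtain s t u where st: "i \<noteq> j" "s \<in> S i" "t \<in> S j" "u \<in> S i" "s < t" "t < u"
    using ints unfolding intersects_def by blast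
  have disj: "S i \<inter> S j = {}"
    using feas \<open>i \<noteq> j\<close> unfolding feasible_def is_schedule_def disjoint_family_on_def by blast
  have tC: "t < ?C i" using st C(2)[of i] by force
  obtain a where a: "a < ?C i" "{a<..?C i} \<subseteq> S i"
    using interval_union_left_neighbourhood[OF feasible_interval_union[OF feas] C(1)] by blast
  obtain c where c: "c < t" "{c<..t} \<subseteq> S j"
    using interval_union_left_neighbourhood[OF feasible_interval_union[OF feas] st(3)] by blast
  \<comment> \<open>The length of the pieces: the piece of \<open>j\<close> must stay after \<open>s\<close>, where \<open>i\<close> is released.\<close>
  define e where "e = Min {?C i - a, t - c, t - s}"
  have e: "0 < e" "e \<le> ?C i - a" "e \<le> t - c" "e \<le> t - s"
    unfolding e_def using a c st by auto
  let ?P = "{?C i - e<..?C i}" and ?Q = "{t - e<..t}"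
  have "?P \<subseteq> {a<..?C i}" "?Q \<subseteq> {c<..t}" using e by auto
  then have P: "?P \<subseteq> S i" and Q: "?Q \<subseteq> S j" using a(2) c(2) by blast+
  \<comment> \<open>As \<open>j\<close> is processed at \<open>t\<close>, the piece of \<open>i\<close> starts at \<open>t\<close> or later.\<close>
  have "t \<notin> ?P" using P st(3) disj by blast
  then have tCe: "t \<le> ?C i - e" using tC by simp
  define S' where "S' = exchange i ?P j ?Q S"
  have feas': "feasible r p S'"
    unfolding S'_def
  proof (rule feasible_exchange[OF feas \<open>i \<noteq> j\<close> P _ Q])
    have "real (r j) < t" "real (r i) < s" using rel st by auto
    then show "?P \<subseteq> {real (r j)<..}" "?Q \<subseteq> {real (r i)<..}" using tCe e by auto
    show "measure lborel ?P = measure lborel ?Q" using e by simp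
  qed
  let ?C' = "completion_time p S'"
  have C': "?C' k \<in> S' k" for k using completion_time_is_greatest[OF feas' pos] by blast
  have "S' i = (S i - ?P) \<union> ?Q" "S' j = (S j - ?Q) \<union> ?P"
    using \<open>i \<noteq> j\<close> unfolding S'_def exchange_def by simp_all
  moreover have "S i - ?P \<subseteq> {..?C i - e}" using C(2)[of i] by auto
  moreover have "?Q \<subseteq> {..?C i - e}" "?P \<subseteq> {..?C j}" using tCe le by auto
  ultimately have "S' i \<subseteq> {..?C i - e}" "S' j \<subseteq> {..?C j}" using C(2)[of j] by blast+
  then have less: "?C' i < ?C i" and "?C' j \<le> ?C j" using C'[of i] C'[of j] e by auto
  moreover have "?C' k = ?C k" if "k \<noteq> i" "k \<noteq> j" for k
    using that unfolding S'_def exchange_def completion_time_def by simp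
  ultimately have "?C' k \<le> ?C k" for k
    using less by (cases "k = i"; cases "k = j") auto
  then have "?C' i = ?C i"
    using optimal_no_smaller_completion_times[OF pos F opt feas'] by blast
  with less show False by simp
qed

theorem theorem2:
  fixes r p :: "'j::finite \<Rightarrow> nat"
    and F :: "('j \<Rightarrow> real) \<Rightarrow> real"
    and S :: "'j \<Rightarrow> real set"
  assumes "\<And>j. 0 < p j"
    and "increasing_objective F"
    and "\<And>S'. optimal r p F S' \<Longrightarrow> no_idle_time p S'"
    and "optimal r p F S"
  shows "\<not> (\<exists>i j. i \<noteq> j \<and> intersecting S i j)"
proof
  assume "\<exists>i j. i \<noteq> j \<and> intersecting S i j"
  then obtain i j where ij: "intersects S i j" "intersects S j i"
    unfolding intersecting_def by blast
  note earlier = optimal_intersects_imp_completes_earlier[OF assms(1,2,4)]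
  show False using earlier[OF ij(1)] earlier[OF ij(2)] by simp
qed

end
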